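(* Let $n\ge 3$ be even. The mean distance of the non-commuting graph $\Gamma_{D_{2n}}$ is $\mu(\Gamma_{D_{2n}})=\dfrac{5n^2-14n+12}{(2n-2)(2n-3)}$.
   Context: $D_{2n}=\langle r,s : r^n=s^2=1,\ srs=r^{-1}\rangle$ is the dihedral group of order $2n$, and $Z(D_{2n})$ is its center. $\Gamma_{D_{2n}}$ is the simple undirected graph with vertex set $D_{2n}-Z(D_{2n})$ in which two distinct vertices $x,y$ are adjacent if and only if $xy\neq yx$. For a graph $\Gamma$, $d(u,v)$ is the length of a shortest $u$–$v$ path; the transmission of a vertex $v$ is $\sigma(v,\Gamma)=\sum_{u\in V(\Gamma)}d(u,v)$; the transmission of $\Gamma$ is $\sigma(\Gamma)=\sum_{u\in V(\Gamma)}\sigma(u,\Gamma)$; and the mean (average) distance of $\Gamma$ is $\mu(\Gamma)=\frac{\sigma(\Gamma)}{p(p-1)}$, where $p=|V(\Gamma)|$. *)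

theory Defs
  imports
    "HOL-Algebra.Group"
    "Graph_Theory.Pair_Digraph"
    "HOL-Library.Extended_Real"
begin

section \<open>Groups given by generators and relations\<close>

text \<open>
  A word over the generators of type \<open>'g\<close> is a list of letters \<open>(g, b)\<close>; the letter \<open>(g, True)\<close>
  stands for the generator \<open>g\<close> and \<open>(g, False)\<close> for its formal inverse. A pair \<open>(u, v)\<close> of words
  in \<open>R\<close> is the relation \<open>u = v\<close>. Two words represent the same element of the presented group iff
  they are related by the smallest congruence that contains \<open>R\<close> and cancels a letter against its
  formal inverse, so the quotient is the free group modulo the normal closure of the relations.
\<close>

type_synonym 'g word = "('g \<times> bool) list"

inductive pres_eq :: "('g word \<times> 'g word) set \<Rightarrow> 'g word \<Rightarrow> 'g word \<Rightarrow> bool"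
  for R :: "('g word \<times> 'g word) set" where
  rel: "(u, v) \<in> R \<Longrightarrow> pres_eq R u v"
| cancel: "pres_eq R [(g, b), (g, \<not> b)] []"
| refl: "pres_eq R u u"
| sym: "pres_eq R u v \<Longrightarrow> pres_eq R v u"
| trans: "pres_eq R u v \<Longrightarrow> pres_eq R v w \<Longrightarrow> pres_eq R u w"
| cong: "pres_eq R u u' \<Longrightarrow> pres_eq R v v' \<Longrightarrow> pres_eq R (u @ v) (u' @ v')"

definition pres_class :: "('g word \<times> 'g word) set \<Rightarrow> 'g word \<Rightarrow> 'g word set" where
  "pres_class R u = {v. pres_eq R u v}"

definition presented_group :: "('g word \<times> 'g word) set \<Rightarrow> 'g word set monoid" where
  "presented_group R =
     \<lparr> carrier = range (pres_class R),
       monoid.mult = (\<lambda>A B. \<Union>u\<in>A. \<Union>v\<in>B. pres_class R (u @ v)),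
       one = pres_class R [] \<rparr>"

lemma pres_class_eq_iff: "pres_class R u = pres_class R v \<longleftrightarrow> pres_eq R u v"
  unfolding pres_class_def by (blast intro: pres_eq.refl pres_eq.sym pres_eq.trans)

lemma presented_group_mult:
  "pres_class R u \<otimes>\<^bsub>presented_group R\<^esub> pres_class R v = pres_class R (u @ v)"
proof -
  have "pres_class R (u' @ v') = pres_class R (u @ v)"
    if "u' \<in> pres_class R u" "v' \<in> pres_class R v" for u' v'
    using that unfolding pres_class_eq_iff
    by (auto simp: pres_class_def intro: pres_eq.cong pres_eq.sym)
  moreover have "u \<in> pres_class R u" "v \<in> pres_class R v"
    by (auto simp: pres_class_def intro: pres_eq.refl)
  ultimately show ?thesis
    unfolding presented_group_def monoid.simps by blast
qed

lemma pres_eq_inverse: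
  "pres_eq R (rev (map (\<lambda>(g, b). (g, \<not> b)) w) @ w) []"
proof (induction w)
  case Nil
  show ?case by (simp add: pres_eq.refl)
next
  case (Cons x w)
  obtain g b where x: "x = (g, b)" by force
  let ?i = "rev (map (\<lambda>(g, b). (g, \<not> b)) w)"
  have "pres_eq R ([(g, \<not> b), (g, b)] @ w) ([] @ w)"
    using pres_eq.cancel[of R g "\<not> b"] by (intro pres_eq.cong pres_eq.refl) simp
  then have "pres_eq R (?i @ ([(g, \<not> b), (g, b)] @ w)) (?i @ w)"
    by (intro pres_eq.cong pres_eq.refl) simp
  then show ?case
    using Cons.IH by (auto simp: x intro: pres_eq.trans)
qed

lemma group_presented_group: "group (presented_group R)"
proof (rule groupI)
  fix x assume "x \<in> carrier (presented_group R)"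
  then obtain w where w: "x = pres_class R w"
    by (auto simp: presented_group_def)
  let ?y = "pres_class R (rev (map (\<lambda>(g, b). (g, \<not> b)) w))"
  have "?y \<otimes>\<^bsub>presented_group R\<^esub> x = pres_class R []"
    by (simp only: w presented_group_mult pres_class_eq_iff pres_eq_inverse)
  then show "\<exists>y\<in>carrier (presented_group R). y \<otimes>\<^bsub>presented_group R\<^esub> x = \<one>\<^bsub>presented_group R\<^esub>"
    by (intro bexI[of _ ?y]) (auto simp: presented_group_def)
next
  show "\<one>\<^bsub>presented_group R\<^esub> \<otimes>\<^bsub>presented_group R\<^esub> x = x"
    if "x \<in> carrier (presented_group R)" for x
    using that presented_group_mult[of R "[]"] by (auto simp: presented_group_def)
next
  have c: "carrier (presented_group R) = range (pres_class R)"
    by (simp add: presented_group_def)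
  show "x \<otimes>\<^bsub>presented_group R\<^esub> y \<in> carrier (presented_group R)"
    if "x \<in> carrier (presented_group R)" "y \<in> carrier (presented_group R)" for x y
    using that by (auto simp: c presented_group_mult)
  show "x \<otimes>\<^bsub>presented_group R\<^esub> y \<otimes>\<^bsub>presented_group R\<^esub> z =
        x \<otimes>\<^bsub>presented_group R\<^esub> (y \<otimes>\<^bsub>presented_group R\<^esub> z)"
    if "x \<in> carrier (presented_group R)" "y \<in> carrier (presented_group R)"
       "z \<in> carrier (presented_group R)" for x y z
    using that by (auto simp: c presented_group_mult)
qed (simp add: presented_group_def)


section \<open>The dihedral group of order \<open>2n\<close>\<close>

datatype dihedral_gen = Rot | Refl

definition dihedral_relations :: "nat \<Rightarrow> (dihedral_gen word \<times> dihedral_gen word) set" where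
  "dihedral_relations n =
     {(replicate n (Rot, True), []),
      ([(Refl, True), (Refl, True)], []),
      ([(Refl, True), (Rot, True), (Refl, True)], [(Rot, False)])}"

definition dihedral_group :: "nat \<Rightarrow> dihedral_gen word set monoid" where
  "dihedral_group n = presented_group (dihedral_relations n)"


section \<open>The non-commuting graph\<close>

definition group_center :: "('a, 'm) monoid_scheme \<Rightarrow> 'a set" where
  "group_center G = {z \<in> carrier G. \<forall>x\<in>carrier G. z \<otimes>\<^bsub>G\<^esub> x = x \<otimes>\<^bsub>G\<^esub> z}"

text \<open>
  As in the graph library, an undirected simple graph is a loop-free symmetric digraph
  without parallel arcs: an edge \<open>{x, y}\<close> is the pair of arcs \<open>(x, y)\<close> and \<open>(y, x)\<close>.
\<close>

definition non_commuting_graph :: "('a, 'm) monoid_scheme \<Rightarrow> 'a pair_pre_digraph" where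
  "non_commuting_graph G =
     \<lparr> pverts = carrier G - group_center G,
       parcs = {(x, y). x \<in> carrier G - group_center G \<and> y \<in> carrier G - group_center G \<and>
                        x \<noteq> y \<and> x \<otimes>\<^bsub>G\<^esub> y \<noteq> y \<otimes>\<^bsub>G\<^esub> x} \<rparr>"

lemma pair_graph_non_commuting_graph:
  assumes "finite (carrier G)"
  shows "pair_graph (non_commuting_graph G)"
proof
  show "finite (parcs (non_commuting_graph G))"
    by (rule finite_subset[of _ "carrier G \<times> carrier G"])
       (auto simp: non_commuting_graph_def assms)
  show "symmetric (with_proj (non_commuting_graph G))"
    by (auto simp: symmetric_def non_commuting_graph_def sym_def)
qed (auto simp: non_commuting_graph_def assms)


section \<open>Distance, transmission and mean distance\<close>

text \<open>
  The distance takes values in the extended naturals; it is \<open>\<infinity>\<close> exactly if there is no path from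
  \<open>u\<close> to \<open>v\<close>. The transmissions of a finite graph and its mean distance are then infinite iff the
  graph is disconnected. The vertex set is meant to be finite.
\<close>

definition graph_dist :: "('a, 'b) pre_digraph \<Rightarrow> 'a \<Rightarrow> 'a \<Rightarrow> enat" where
  "graph_dist \<Gamma> u v = (INF p\<in>{p. pre_digraph.apath \<Gamma> u p v}. enat (length p))"

definition vertex_transmission :: "'a \<Rightarrow> ('a, 'b) pre_digraph \<Rightarrow> enat" where
  "vertex_transmission v \<Gamma> = (\<Sum>u\<in>verts \<Gamma>. graph_dist \<Gamma> u v)"

definition transmission :: "('a, 'b) pre_digraph \<Rightarrow> enat" where
  "transmission \<Gamma> = (\<Sum>u\<in>verts \<Gamma>. vertex_transmission u \<Gamma>)"

definition mean_distance :: "('a, 'b) pre_digraph \<Rightarrow> ereal" where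
  "mean_distance \<Gamma> =
     ereal_of_enat (transmission \<Gamma>) /
     ereal (real (card (verts \<Gamma>)) * (real (card (verts \<Gamma>)) - 1))"

end

theory Submission
  imports Defs
begin

text \<open>
  The mean distance is governed by two facts. The first holds for every finite group \<open>G\<close>: two
  vertices of the non-commuting graph are at distance at most \<open>2\<close>. The centralizers of two
  non-central elements are proper subgroups, and a group is never the union of two proper
  subgroups, so some element commutes with neither of them and is a common neighbour
  (\<open>non_commuting_common_neighbour\<close>). Hence an ordered pair of distinct vertices is at distance
  \<open>1\<close> or \<open>2\<close> according to whether it is an arc, and with \<open>p\<close> vertices and \<open>a\<close> arcs the transmission
  is \<open>2p(p - 1) - a\<close> (\<open>transmission_diameter_two\<close>). No distance has to be computed vertex by vertex;
  only the order of the centre and the number of ordered pairs of non-commuting elements matter.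

  The second fact is a normal form for the presented group: its elements are \<open>r\<^sup>k s\<^sup>e\<close> with
  \<open>0 \<le> k < n\<close> and \<open>e \<in> {0, 1}\<close>, without repetition. The relations bring every word into this form.
  That no further collapse occurs is seen from a concrete model: the pairs \<open>(k, e)\<close> with the
  multiplication of the semidirect product of \<open>\<int>/n\<close> by \<open>\<int>/2\<close> satisfy the relations, so the
  evaluation of words in the model is constant on classes (\<open>dihedral_group_iso_pairs\<close>).

  For \<open>n = 2m\<close> with \<open>m > 1\<close> commutation in the model is a divisibility condition. The centre consists
  of \<open>1\<close> and \<open>r\<^sup>m\<close>, so \<open>p = 2n - 2\<close>. Each of the \<open>n - 2\<close> non-central rotations fails to commute with
  exactly the \<open>n\<close> reflections, and each of the \<open>n\<close> reflections fails to commute with \<open>n - 2\<close>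
  rotations and \<open>n - 2\<close> reflections, which gives \<open>a = 3n(n - 2)\<close>. Then
  \<open>2(2n - 2)(2n - 3) - 3n(n - 2) = 5n\<^sup>2 - 14n + 12\<close>.
\<close>

section \<open>Transmission of graphs of diameter at most two\<close>
lemma (in pair_graph) graph_dist_diameter_two:
  assumes uv: "u \<in> pverts G" "v \<in> pverts G"
    and common: "u \<noteq> v \<Longrightarrow> (u, v) \<notin> parcs G \<Longrightarrow> \<exists>w. (u, w) \<in> parcs G \<and> (w, v) \<in> parcs G"
  shows "graph_dist (with_proj G) u v =
    enat (if u = v then 0 else if (u, v) \<in> parcs G then 1 else 2)"
    (is "_ = enat ?d")
proof -
  have "\<exists>p. apath u p v \<and> length p = ?d"
  proof -
    consider "u = v" | "u \<noteq> v" "(u, v) \<in> parcs G" | "u \<noteq> v" "(u, v) \<notin> parcs G" by blast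
    then show ?thesis
    proof cases
      case 1
      then show ?thesis using uv by (intro exI[of _ "[]"]) (simp add: apath_Nil_iff)
    next
      case 2
      then show ?thesis using uv
        by (intro exI[of _ "[(u, v)]"]) (simp add: apath_Nil_iff apath_Cons_iff)
    next
      case 3
      then obtain w where w: "(u, w) \<in> parcs G" "(w, v) \<in> parcs G" using common by blast
      have "u \<noteq> w" "w \<noteq> v" using pair_no_loops w by force+
      then show ?thesis using uv 3 w
        by (intro exI[of _ "[(u, w), (w, v)]"]) (simp add: apath_Nil_iff apath_Cons_iff)
    qed
  qed
  moreover have "?d \<le> length p" if p: "apath u p v" for p
  proof (cases p)
    case Nil
    then show ?thesis using p by (simp add: apath_Nil_iff)
  next
    case (Cons e q)
    then show ?thesis using p
      by (cases q; cases e) (auto simp: apath_Nil_iff apath_Cons_iff)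
  qed
  ultimately have "(INF p\<in>{p. apath u p v}. enat (length p)) = enat ?d"
    by (intro antisym INF_greatest) (auto intro: INF_lower2)
  then show ?thesis by (simp add: graph_dist_def)
qed

text \<open>
  Adding \<open>1\<close> to the distance for each arc makes every ordered pair of distinct vertices
  contribute exactly \<open>2\<close>. This also shows that the subtraction below does not truncate.
\<close>
lemma (in pair_graph) transmission_diameter_two:
  assumes common: "\<And>u v. u \<in> pverts G \<Longrightarrow> v \<in> pverts G \<Longrightarrow> u \<noteq> v \<Longrightarrow> (u, v) \<notin> parcs G \<Longrightarrow>
      \<exists>w. (u, w) \<in> parcs G \<and> (w, v) \<in> parcs G"
  shows "transmission (with_proj G) =
    enat (2 * (card (pverts G) * (card (pverts G) - 1)) - card (parcs G))"
proof -
  let ?V = "pverts G" and ?A = "parcs G"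
  define d :: "_ \<Rightarrow> _ \<Rightarrow> nat" where "d u v = (if u = v then 0 else if (u, v) \<in> ?A then 1 else 2)" for u v
  have enat_sum: "(\<Sum>x\<in>S. enat (f x)) = enat (\<Sum>x\<in>S. f x)" for f and S :: "'a set"
    by (simp flip: of_nat_eq_enat)
  have "transmission (with_proj G) = (\<Sum>v\<in>?V. \<Sum>u\<in>?V. enat (d u v))"
    by (simp add: transmission_def vertex_transmission_def graph_dist_diameter_two common d_def)
  also have "\<dots> = enat (\<Sum>v\<in>?V. \<Sum>u\<in>?V. d u v)"
    by (simp add: enat_sum)
  finally have trans: "transmission (with_proj G) = enat (\<Sum>v\<in>?V. \<Sum>u\<in>?V. d u v)" .
  have fin: "finite ?V" by (rule pair_finite_verts)
  have "(\<Sum>v\<in>?V. \<Sum>u\<in>?V. d u v) + card ?A = 2 * (card ?V * (card ?V - 1))"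
  proof -
    \<comment> \<open>The number of arcs, written as a sum of the same shape as the transmission.\<close>
    have "(\<Sum>v\<in>?V. \<Sum>u\<in>?V. of_bool ((u, v) \<in> ?A)) = (\<Sum>(u, v)\<in>?V \<times> ?V. of_bool ((u, v) \<in> ?A) :: nat)"
      by (subst sum.swap) (simp only: sum.cartesian_product)
    also have "\<dots> = card (?V \<times> ?V \<inter> ?A)"
      using fin by (simp add: case_prod_beta)
    also have "?V \<times> ?V \<inter> ?A = ?A"
      using arc_fst_in_verts arc_snd_in_verts by force
    finally have "card ?A = (\<Sum>v\<in>?V. \<Sum>u\<in>?V. of_bool ((u, v) \<in> ?A))" ..
    then have "(\<Sum>v\<in>?V. \<Sum>u\<in>?V. d u v) + card ?A = (\<Sum>v\<in>?V. \<Sum>u\<in>?V. d u v + of_bool ((u, v) \<in> ?A))"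
      by (simp add: sum.distrib)
    also have "\<dots> = (\<Sum>v\<in>?V. \<Sum>u\<in>?V. if u = v then 0 else 2)"
      using pair_no_loops[of "(v, v)" for v] by (intro sum.cong[OF HOL.refl]) (auto simp: d_def)
    also have "\<dots> = (\<Sum>v\<in>?V. 2 * (card ?V - 1))"
    proof (intro sum.cong HOL.refl)
      fix v assume "v \<in> ?V"
      then show "(\<Sum>u\<in>?V. if u = v then 0 else 2) = 2 * (card ?V - 1)"
        using fin by (subst sum.remove[of _ v]) auto
    qed
    finally show ?thesis by simp
  qed
  then show ?thesis using trans by simp
qed

section \<open>Non-commuting graphs have diameter at most two\<close>
lemma pverts_non_commuting_graph:
  "pverts (non_commuting_graph G) = carrier G - group_center G"
  by (simp add: non_commuting_graph_def)

text \<open>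
  Elements that fail to commute are distinct and non-central, so the arcs are simply all
  non-commuting pairs of the group.
\<close>
lemma parcs_non_commuting_graph:
  "parcs (non_commuting_graph G) =
    {(x, y) \<in> carrier G \<times> carrier G. x \<otimes>\<^bsub>G\<^esub> y \<noteq> y \<otimes>\<^bsub>G\<^esub> x}"
  by (auto simp: non_commuting_graph_def group_center_def; metis)

lemma (in group) commute_mult_cancel_left:
  assumes "a \<in> carrier G" "b \<in> carrier G" "x \<in> carrier G" "a \<otimes> x = x \<otimes> a"
  shows "(a \<otimes> b) \<otimes> x = x \<otimes> (a \<otimes> b) \<longleftrightarrow> b \<otimes> x = x \<otimes> b"
  using assms by (metis m_assoc m_closed Units_eq Units_l_cancel)

lemma (in group) commute_mult_cancel_right:
  assumes "a \<in> carrier G" "b \<in> carrier G" "x \<in> carrier G" "b \<otimes> x = x \<otimes> b"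
  shows "(a \<otimes> b) \<otimes> x = x \<otimes> (a \<otimes> b) \<longleftrightarrow> a \<otimes> x = x \<otimes> a"
  using assms by (metis m_assoc m_closed right_cancel)

text \<open>
  Let \<open>a\<close> not commute with \<open>x\<close> and \<open>b\<close> not commute with \<open>y\<close>. If \<open>a\<close> commutes with \<open>y\<close> and \<open>b\<close> commutes
  with \<open>x\<close>, then \<open>ab\<close> commutes with neither. This is the classical argument that a group is not a
  union of two proper subgroups, here the centralizers of \<open>x\<close> and \<open>y\<close>.
\<close>
lemma (in group) non_commuting_common_neighbour:
  assumes "x \<in> carrier G - group_center G" "y \<in> carrier G - group_center G"
  obtains z where "z \<in> carrier G" "z \<otimes> x \<noteq> x \<otimes> z" "z \<otimes> y \<noteq> y \<otimes> z"
proof -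
  obtain a b where ab: "a \<in> carrier G" "a \<otimes> x \<noteq> x \<otimes> a" "b \<in> carrier G" "b \<otimes> y \<noteq> y \<otimes> b"
    using assms by (force simp: group_center_def)
  consider "a \<otimes> y \<noteq> y \<otimes> a" | "b \<otimes> x \<noteq> x \<otimes> b" | "a \<otimes> y = y \<otimes> a" "b \<otimes> x = x \<otimes> b" by blast
  then show thesis
  proof cases
    case 3
    with ab assms show thesis
      by (intro that[of "a \<otimes> b"]) (simp_all add: commute_mult_cancel_left commute_mult_cancel_right)
  qed (use ab that in blast)+
qed

lemma (in group) transmission_non_commuting_graph:
  assumes "finite (carrier G)"
  shows "transmission (with_proj (non_commuting_graph G)) =
    enat (2 * (card (carrier G - group_center G) * (card (carrier G - group_center G) - 1)) -
      card {(x, y) \<in> carrier G \<times> carrier G. x \<otimes> y \<noteq> y \<otimes> x})"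
proof -
  interpret \<Gamma>: pair_graph "non_commuting_graph G"
    using assms by (rule pair_graph_non_commuting_graph)
  have "\<exists>w. (u, w) \<in> parcs (non_commuting_graph G) \<and> (w, v) \<in> parcs (non_commuting_graph G)"
    if uv: "u \<in> pverts (non_commuting_graph G)" "v \<in> pverts (non_commuting_graph G)" for u v
  proof -
    obtain z where "z \<in> carrier G" "z \<otimes> u \<noteq> u \<otimes> z" "z \<otimes> v \<noteq> v \<otimes> z"
      by (rule non_commuting_common_neighbour[OF uv[unfolded pverts_non_commuting_graph]])
    then show ?thesis
      using uv by (intro exI[of _ z]) (auto simp: parcs_non_commuting_graph pverts_non_commuting_graph)
  qed
  then show ?thesis
    using \<Gamma>.transmission_diameter_two
    by (simp add: pverts_non_commuting_graph parcs_non_commuting_graph)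
qed

section \<open>Counting in an isomorphic model\<close>

text \<open>
  The next two lemmas move the two counts that determine the transmission from a group to a model
  on an arbitrary carrier set, in which calculation is easier.
\<close>
lemma card_center_bij:
  fixes G (structure)
  assumes bij: "bij_betw \<phi> P (carrier G)"
    and mult: "\<And>x y. \<phi> x \<otimes> \<phi> y = \<phi> (f x y)"
    and closed: "\<And>x y. f x y \<in> P"
  shows "card (group_center G) = card {z \<in> P. \<forall>x\<in>P. f z x = f x z}"
proof -
  have inj: "inj_on \<phi> P" and carrier: "carrier G = \<phi> ` P"
    using bij by (simp_all add: bij_betw_def)
  have "\<phi> x \<otimes> \<phi> y = \<phi> y \<otimes> \<phi> x \<longleftrightarrow> f x y = f y x" for x y
    by (simp add: mult inj_on_eq_iff[OF inj] closed)
  then have "group_center G = \<phi> ` {z \<in> P. \<forall>x\<in>P. f z x = f x z}"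
    by (auto simp: group_center_def carrier)
  then show ?thesis using inj by (simp add: card_image inj_on_subset)
qed

lemma card_non_commuting_pairs_bij:
  fixes G (structure)
  assumes bij: "bij_betw \<phi> P (carrier G)"
    and mult: "\<And>x y. \<phi> x \<otimes> \<phi> y = \<phi> (f x y)"
    and closed: "\<And>x y. f x y \<in> P"
  shows "card {(x, y) \<in> carrier G \<times> carrier G. x \<otimes> y \<noteq> y \<otimes> x} =
    card {(x, y) \<in> P \<times> P. f x y \<noteq> f y x}"
proof -
  have inj: "inj_on \<phi> P" and carrier: "carrier G = \<phi> ` P"
    using bij by (simp_all add: bij_betw_def)
  have "\<phi> x \<otimes> \<phi> y = \<phi> y \<otimes> \<phi> x \<longleftrightarrow> f x y = f y x" for x y
    by (simp add: mult inj_on_eq_iff[OF inj] closed)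
  then have "{(x, y) \<in> carrier G \<times> carrier G. x \<otimes> y \<noteq> y \<otimes> x} =
      map_prod \<phi> \<phi> ` {(x, y) \<in> P \<times> P. f x y \<noteq> f y x}"
    by (auto simp: carrier map_prod_def image_iff)
  also have "card \<dots> = card {(x, y) \<in> P \<times> P. f x y \<noteq> f y x}"
    by (intro card_image inj_on_subset[OF map_prod_inj_on[OF inj inj]]) auto
  finally show ?thesis .
qed

section \<open>A concrete model of the dihedral group\<close>

text \<open>
  The pair \<open>(k, e)\<close> stands for \<open>r\<^sup>k s\<^sup>e\<close>. The sign change comes from \<open>s r\<^sup>b = r\<^sup>-\<^sup>b s\<close>. The first
  components of the arguments are arbitrary integers and only the result is reduced, so that
  letters such as \<open>r\<^sup>-\<^sup>1\<close> can be multiplied without first being normalized.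
\<close>
definition dihedral_mult :: "nat \<Rightarrow> int \<times> bool \<Rightarrow> int \<times> bool \<Rightarrow> int \<times> bool" where
  "dihedral_mult n = (\<lambda>(a, e) (b, f). ((if e then a - b else a + b) mod int n, e \<noteq> f))"

definition dihedral_pairs :: "nat \<Rightarrow> (int \<times> bool) set" where
  "dihedral_pairs n = {0..<int n} \<times> UNIV"

lemma dihedral_mult_in_pairs: "n > 0 \<Longrightarrow> dihedral_mult n x y \<in> dihedral_pairs n"
  by (auto simp: dihedral_mult_def dihedral_pairs_def split: prod.splits)

lemma dihedral_mult_assoc:
  "dihedral_mult n (dihedral_mult n x y) z = dihedral_mult n x (dihedral_mult n y z)"
  by (auto simp: dihedral_mult_def mod_simps algebra_simps split: prod.splits)

lemma dihedral_mult_unit_left: "x \<in> dihedral_pairs n \<Longrightarrow> dihedral_mult n (0, False) x = x"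
  by (auto simp: dihedral_mult_def dihedral_pairs_def)

text \<open>The letter for \<open>s\<^sup>-\<^sup>1\<close> has the same value as that for \<open>s\<close>, because \<open>s\<close> is an involution.\<close>
fun letter_pair :: "dihedral_gen \<times> bool \<Rightarrow> int \<times> bool" where
  "letter_pair (Rot, b) = (if b then 1 else - 1, False)"
| "letter_pair (Refl, b) = (0, True)"

definition word_pair :: "nat \<Rightarrow> dihedral_gen word \<Rightarrow> int \<times> bool" where
  "word_pair n w = foldr (\<lambda>x. dihedral_mult n (letter_pair x)) w (0, False)"

lemma word_pair_simps [simp]:
  "word_pair n [] = (0, False)"
  "word_pair n (x # w) = dihedral_mult n (letter_pair x) (word_pair n w)"
  by (simp_all add: word_pair_def)

lemma word_pair_in_pairs: "n > 0 \<Longrightarrow> word_pair n w \<in> dihedral_pairs n"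
  by (cases w) (simp_all add: dihedral_mult_in_pairs, simp add: dihedral_pairs_def)

lemma word_pair_append:
  "n > 0 \<Longrightarrow> word_pair n (u @ v) = dihedral_mult n (word_pair n u) (word_pair n v)"
  by (induction u) (simp_all add: dihedral_mult_unit_left word_pair_in_pairs dihedral_mult_assoc)

lemma word_pair_replicate_Rot: "word_pair n (replicate k (Rot, True)) = (int k mod int n, False)"
  by (induction k) (simp_all add: dihedral_mult_def mod_simps)

text \<open>
  The model satisfies the defining relations. This is what prevents distinct normal forms from
  being identified in the presented group.
\<close>
lemma word_pair_cong:
  assumes "n > 0" "pres_eq (dihedral_relations n) u v"
  shows "word_pair n u = word_pair n v"
  using assms(2)
proof induction
  case (rel u v)
  then show ?case
    by (auto simp: dihedral_relations_def word_pair_replicate_Rot) (auto simp: dihedral_mult_def mod_minus_eq)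
next
  case (cancel g b)
  then show ?case by (cases g) (auto simp: dihedral_mult_def mod_simps)
qed (simp_all add: word_pair_append assms(1))

section \<open>Normal forms in the presented dihedral group\<close>
definition (in group) dihedral_elem :: "'a \<Rightarrow> 'a \<Rightarrow> int \<times> bool \<Rightarrow> 'a" where
  "dihedral_elem r s = (\<lambda>(k, e). r [^] k \<otimes> (if e then s else \<one>))"

text \<open>
  Any two elements satisfying the dihedral relations multiply like the model: \<open>r\<^sup>n = 1\<close> allows
  exponents to be reduced modulo \<open>n\<close>, and conjugation by \<open>s\<close> is an endomorphism that sends \<open>r\<close> to its
  inverse and therefore \<open>r\<^sup>k\<close> to \<open>r\<^sup>-\<^sup>k\<close>.
\<close>
lemma (in group) dihedral_elem_mult:
  assumes r: "r \<in> carrier G" and s: "s \<in> carrier G"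
    and rn: "r [^] n = \<one>" and ss: "s \<otimes> s = \<one>" and srs: "s \<otimes> r \<otimes> s = inv r"
  shows "dihedral_elem r s x \<otimes> dihedral_elem r s y = dihedral_elem r s (dihedral_mult n x y)"
proof -
  have pow_mod: "r [^] (k mod int n) = r [^] k" for k :: int
  proof -
    have "r [^] k = r [^] (int n * (k div int n) + k mod int n)" by simp
    also have "\<dots> = (r [^] int n) [^] (k div int n) \<otimes> r [^] (k mod int n)"
      using r by (simp only: int_pow_mult int_pow_pow)
    also have "\<dots> = r [^] (k mod int n)" using r rn by (simp add: int_pow_int)
    finally show ?thesis ..
  qed
  have conj: "s \<otimes> r [^] k = r [^] (- k) \<otimes> s" for k :: int
  proof -
    have "(\<lambda>x. s \<otimes> x \<otimes> s) \<in> hom G G"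
    proof (rule homI)
      fix x y assume xy: "x \<in> carrier G" "y \<in> carrier G"
      have "(s \<otimes> x \<otimes> s) \<otimes> (s \<otimes> y \<otimes> s) = s \<otimes> x \<otimes> (s \<otimes> s) \<otimes> y \<otimes> s"
        using xy s by (simp only: m_assoc m_closed)
      then show "s \<otimes> (x \<otimes> y) \<otimes> s = (s \<otimes> x \<otimes> s) \<otimes> (s \<otimes> y \<otimes> s)"
        using xy s by (simp add: ss m_assoc)
    qed (use s in simp)
    then have "s \<otimes> r [^] k \<otimes> s = inv r [^] k"
      using hom_int_pow[of "\<lambda>x. s \<otimes> x \<otimes> s" G G r k] r srs is_group by simp
    then have "s \<otimes> r [^] k \<otimes> s \<otimes> s = r [^] (- k) \<otimes> s"
      using r by (simp add: int_pow_inv int_pow_neg)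
    then show ?thesis using r s by (simp add: m_assoc ss)
  qed
  obtain a e b f where xy: "x = (a, e)" "y = (b, f)" by force
  have flip: "r [^] a \<otimes> s \<otimes> (r [^] b \<otimes> t) = r [^] (a - b) \<otimes> (s \<otimes> t)" if "t \<in> carrier G" for t
  proof -
    have "r [^] a \<otimes> s \<otimes> (r [^] b \<otimes> t) = r [^] a \<otimes> (s \<otimes> r [^] b) \<otimes> t"
      using r s that by (simp add: m_assoc)
    also have "\<dots> = r [^] a \<otimes> r [^] (- b) \<otimes> (s \<otimes> t)"
      unfolding conj using r s that by (simp add: m_assoc)
    also have "r [^] a \<otimes> r [^] (- b) = r [^] (a - b)"
      using r int_pow_mult[of r a "- b"] by simp
    finally show ?thesis .
  qed
  show ?thesis
    using r s flip[of s] flip[of \<one>]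
    by (auto simp: xy dihedral_elem_def dihedral_mult_def pow_mod ss int_pow_mult m_assoc)
qed

text \<open>
  The map \<open>(k, e) \<mapsto> r\<^sup>k s\<^sup>e\<close> is onto because each word has the same class as the normal form of
  its value in the model. It is injective because evaluating any word of the class in the model
  recovers \<open>(k, e)\<close>.
\<close>
lemma dihedral_group_iso_pairs:
  assumes n: "n > 0"
  obtains \<phi> where "bij_betw \<phi> (dihedral_pairs n) (carrier (dihedral_group n))"
    and "\<And>x y. \<phi> x \<otimes>\<^bsub>dihedral_group n\<^esub> \<phi> y = \<phi> (dihedral_mult n x y)"
proof -
  let ?R = "dihedral_relations n" and ?G = "dihedral_group n"
  interpret group ?G unfolding dihedral_group_def by (rule group_presented_group)
  let ?c = "pres_class ?R"
  have c_mult: "?c u \<otimes>\<^bsub>?G\<^esub> ?c v = ?c (u @ v)" for u v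
    by (simp add: dihedral_group_def presented_group_mult)
  have carrier: "carrier ?G = range ?c" and one: "\<one>\<^bsub>?G\<^esub> = ?c []"
    by (simp_all add: dihedral_group_def presented_group_def)
  define r s where "r = ?c [(Rot, True)]" and "s = ?c [(Refl, True)]"
  have r: "r \<in> carrier ?G" and s: "s \<in> carrier ?G" by (simp_all add: carrier r_def s_def)
  have r_pow: "?c (replicate k (Rot, True)) = r [^]\<^bsub>?G\<^esub> k" for k :: nat
  proof (induction k)
    case (Suc k)
    have "?c (replicate (Suc k) (Rot, True)) = ?c (replicate k (Rot, True)) \<otimes>\<^bsub>?G\<^esub> r"
      by (simp add: r_def c_mult replicate_append_same)
    then show ?case by (simp add: Suc)
  qed (simp add: one)
  have rn: "r [^]\<^bsub>?G\<^esub> n = \<one>\<^bsub>?G\<^esub>" and ss: "s \<otimes>\<^bsub>?G\<^esub> s = \<one>\<^bsub>?G\<^esub>"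
    unfolding r_pow[symmetric] unfolding s_def c_mult one pres_class_eq_iff
    by (rule pres_eq.rel; simp add: dihedral_relations_def)+
  have inv_r: "inv\<^bsub>?G\<^esub> r = ?c [(Rot, False)]"
  proof (rule inv_equality)
    show "?c [(Rot, False)] \<otimes>\<^bsub>?G\<^esub> r = \<one>\<^bsub>?G\<^esub>"
      using pres_eq.cancel[of ?R Rot False] by (simp add: r_def c_mult one pres_class_eq_iff)
  qed (simp_all add: carrier r_def)
  have srs: "s \<otimes>\<^bsub>?G\<^esub> r \<otimes>\<^bsub>?G\<^esub> s = inv\<^bsub>?G\<^esub> r"
    unfolding inv_r unfolding r_def s_def c_mult pres_class_eq_iff
    by (rule pres_eq.rel) (simp add: dihedral_relations_def)
  have s_inv: "?c [(Refl, False)] = s"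
  proof -
    have "?c [(Refl, False)] \<otimes>\<^bsub>?G\<^esub> s = \<one>\<^bsub>?G\<^esub>"
      using pres_eq.cancel[of ?R Refl False] by (simp add: s_def c_mult one pres_class_eq_iff)
    then show ?thesis using ss s right_cancel by (metis carrier rangeI)
  qed
  let ?\<phi> = "dihedral_elem r s"
  have mult: "?\<phi> x \<otimes>\<^bsub>?G\<^esub> ?\<phi> y = ?\<phi> (dihedral_mult n x y)" for x y
    by (rule dihedral_elem_mult[OF r s rn ss srs])
  have letter: "?c [x] = ?\<phi> (letter_pair x)" for x
    using r s inv_r s_inv inv_closed[OF r]
    by (cases x rule: letter_pair.cases; cases "snd x")
      (simp_all add: dihedral_elem_def r_def s_def int_pow_neg)
  have word: "?c w = ?\<phi> (word_pair n w)" for w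
  proof (induction w)
    case Nil
    then show ?case by (simp add: dihedral_elem_def flip: one)
  next
    case (Cons x w)
    have "?c (x # w) = ?c [x] \<otimes>\<^bsub>?G\<^esub> ?c w" by (simp add: c_mult)
    then show ?case by (simp add: Cons letter mult)
  qed
  \<comment> \<open>The inverse map evaluates an arbitrarily chosen word of the class in the model.\<close>
  have "inj_on ?\<phi> (dihedral_pairs n)"
  proof (rule inj_on_inverseI)
    fix x assume x: "x \<in> dihedral_pairs n"
    obtain k e where ke: "x = (int k, e)" "k < n"
    proof
      show "x = (int (nat (fst x)), snd x)" "nat (fst x) < n"
        using x by (auto simp: dihedral_pairs_def)
    qed
    let ?w = "replicate k (Rot, True) @ (if e then [(Refl, True)] else [])"
    have "?c ?w = ?\<phi> x"
      using r s by (cases e) (simp_all add: dihedral_elem_def ke r_pow s_def int_pow_int flip: c_mult)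
    moreover have "word_pair n ?w = x"
      using n ke by (auto simp: word_pair_append word_pair_replicate_Rot) (auto simp: dihedral_mult_def)
    moreover have "word_pair n (SOME w. ?c w = ?c ?w) = word_pair n ?w"
    proof (rule word_pair_cong[OF n])
      show "pres_eq ?R (SOME w. ?c w = ?c ?w) ?w"
        unfolding pres_class_eq_iff[symmetric] by (rule someI) (rule HOL.refl)
    qed
    ultimately show "(\<lambda>A. word_pair n (SOME w. ?c w = A)) (?\<phi> x) = x" by simp
  qed
  moreover have "?\<phi> ` dihedral_pairs n = carrier ?G"
  proof
    show "?\<phi> ` dihedral_pairs n \<subseteq> carrier ?G"
      using r s by (auto simp: dihedral_elem_def)
    show "carrier ?G \<subseteq> ?\<phi> ` dihedral_pairs n"
      using word word_pair_in_pairs[OF n] by (auto simp: carrier)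
  qed
  ultimately show thesis using mult by (intro that[of ?\<phi>]) (simp_all add: bij_betw_def)
qed

section \<open>Centre and non-commuting pairs for even \<open>n\<close>\<close>

text \<open>
  The two products differ by \<open>2b\<close>, \<open>2a\<close> or \<open>2(b - a)\<close> in the exponent of \<open>r\<close>, or not at all for two
  rotations. Since \<open>n = 2m\<close>, divisibility of the double by \<open>n\<close> is divisibility by \<open>m\<close>.
\<close>
lemma dihedral_mult_commute_iff:
  assumes "n = 2 * m"
  shows "dihedral_mult n (a, e) (b, f) = dihedral_mult n (b, f) (a, e) \<longleftrightarrow>
    (if e then int m dvd (if f then b - a else b) else f \<longrightarrow> int m dvd a)"
proof -
  have twice: "int n dvd 2 * c \<longleftrightarrow> int m dvd c" for c
    by (simp add: assms)
  show ?thesis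
    using twice[of b] twice[of a] twice[of "b - a"] twice[of "a - b"]
    by (auto simp: dihedral_mult_def mod_eq_dvd_iff algebra_simps dvd_diff_commute)
qed

lemma card_residue_class_double:
  assumes "m > 0"
  shows "card {b \<in> {0..<2 * int m}. int m dvd b - a} = 2"
proof -
  have "b = a mod int m \<or> b = a mod int m + int m" if b: "0 \<le> b" "b < 2 * int m" "int m dvd b - a" for b
  proof -
    have ab: "a mod int m = b mod int m" using b(3) by (simp add: mod_eq_dvd_iff dvd_diff_commute)
    show ?thesis
    proof (cases "b < int m")
      case True
      then show ?thesis using ab b by simp
    next
      case False
      then have "(b - int m) mod int m = b - int m" using b by (intro mod_pos_pos_trivial) auto
      then show ?thesis using ab by simp
    qed
  qed
  moreover have "int m dvd a mod int m - a" "int m dvd a mod int m + int m - a"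
    by (simp_all flip: mod_eq_dvd_iff)
  ultimately have "{b \<in> {0..<2 * int m}. int m dvd b - a} = {a mod int m, a mod int m + int m}"
    using assms pos_mod_bound[of "int m" a] pos_mod_sign[of "int m" a]
    by (auto simp del: pos_mod_bound pos_mod_sign)
  then show ?thesis using assms by simp
qed

lemma card_non_residue_class_double:
  assumes "n = 2 * m" "m > 0"
  shows "card {b \<in> {0..<int n}. \<not> int m dvd b - a} = n - 2"
proof -
  have "{b \<in> {0..<int n}. \<not> int m dvd b - a} = {0..<int n} - {b \<in> {0..<2 * int m}. int m dvd b - a}"
    using assms by auto
  also have "card \<dots> = n - 2"
    by (subst card_Diff_subset) (use assms card_residue_class_double[of m a] in \<open>auto intro: finite_subset[of _ "{0..<2 * int m}"]\<close>)
  finally show ?thesis .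
qed

text \<open>
  A central element commutes with \<open>r\<close>, hence is a rotation because \<open>m > 1\<close>, and commutes with \<open>s\<close>,
  hence is \<open>r\<^sup>a\<close> with \<open>m\<close> dividing \<open>a\<close>. The witnesses \<open>(1, False)\<close> and \<open>(0, True)\<close> below are
  \<open>r\<close> and \<open>s\<close>.
\<close>
lemma card_dihedral_center:
  assumes "n = 2 * m" "m > 1"
  shows "card {z \<in> dihedral_pairs n. \<forall>x\<in>dihedral_pairs n. dihedral_mult n z x = dihedral_mult n x z} = 2"
    (is "card ?Z = 2")
proof -
  have "?Z = {b \<in> {0..<2 * int m}. int m dvd b - 0} \<times> {False}"
  proof
    show "?Z \<subseteq> {b \<in> {0..<2 * int m}. int m dvd b - 0} \<times> {False}"
    proof
      fix z assume z: "z \<in> ?Z"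
      obtain a e where ae: "z = (a, e)" by force
      have "dihedral_mult n z (1, False) = dihedral_mult n (1, False) z"
        and "dihedral_mult n z (0, True) = dihedral_mult n (0, True) z"
        using z assms by (auto simp: dihedral_pairs_def)
      then have "\<not> e" "int m dvd a"
        using assms(2) by (auto simp: ae dihedral_mult_commute_iff[OF assms(1)] split: if_splits)
      then show "z \<in> {b \<in> {0..<2 * int m}. int m dvd b - 0} \<times> {False}"
        using z by (simp add: ae dihedral_pairs_def assms(1))
    qed
  qed (auto simp: dihedral_mult_commute_iff[OF HOL.refl] dihedral_pairs_def assms(1))
  then show ?thesis using card_residue_class_double[of m 0] assms by (simp add: card_cartesian_product)
qed

text \<open>
  The count is the sum over all elements of the number of elements that do not commute with it:
  \<open>2(n - 2)\<close> for each of the \<open>n\<close> reflections, \<open>n\<close> for each of the \<open>n - 2\<close> rotations \<open>r\<^sup>a\<close> with \<open>m\<close> not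
  dividing \<open>a\<close>, and \<open>0\<close> for the two central rotations.
\<close>
lemma card_dihedral_non_commuting:
  assumes n: "n = 2 * m" and m: "m > 0"
  shows "card {(x, y) \<in> dihedral_pairs n \<times> dihedral_pairs n. dihedral_mult n x y \<noteq> dihedral_mult n y x} =
    3 * n * (n - 2)"
proof -
  define N where "N x = {y \<in> dihedral_pairs n. dihedral_mult n x y \<noteq> dihedral_mult n y x}" for x
  note comm = dihedral_mult_commute_iff[OF n]
  have fin: "finite (dihedral_pairs n)" by (simp add: dihedral_pairs_def)
  have refl: "card (N (a, True)) = 2 * (n - 2)" for a
  proof -
    \<comment> \<open>\<open>A 0\<close> and \<open>A a\<close> are the exponents of the rotations and of the reflections to be counted.\<close>
    define A where "A c = {b \<in> {0..<int n}. \<not> int m dvd b - c}" for c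
    have A: "finite (A c)" "card (A c) = n - 2" for c
      unfolding A_def card_non_residue_class_double[OF n m]
      by (rule finite_subset[of _ "{0..<int n}"]) auto
    have "N (a, True) = A 0 \<times> {False} \<union> A a \<times> {True}"
      by (auto simp: N_def A_def dihedral_pairs_def comm split: if_splits)
    also have "card \<dots> = 2 * (n - 2)"
      by (subst card_Un_disjoint) (auto simp: card_cartesian_product A)
    finally show ?thesis .
  qed
  have rot: "card (N (a, False)) = n * of_bool (\<not> int m dvd a - 0)" for a
  proof -
    have "N (a, False) = (if int m dvd a then {} else {0..<int n} \<times> {True})"
      by (auto simp: N_def dihedral_pairs_def comm)
    then show ?thesis by (simp add: card_cartesian_product)
  qed
  have "{(x, y) \<in> dihedral_pairs n \<times> dihedral_pairs n. dihedral_mult n x y \<noteq> dihedral_mult n y x} =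
      Sigma (dihedral_pairs n) N"
    by (auto simp: N_def)
  also have "card \<dots> = (\<Sum>x\<in>dihedral_pairs n. card (N x))"
    using fin by (intro card_SigmaI) (auto simp: N_def)
  also have "\<dots> = (\<Sum>a\<in>{0..<int n}. \<Sum>e\<in>UNIV. card (N (a, e)))"
    by (simp add: dihedral_pairs_def sum.cartesian_product)
  also have "\<dots> = (\<Sum>a\<in>{0..<int n}. n * of_bool (\<not> int m dvd a - 0)) + n * (2 * (n - 2))"
    by (simp only: UNIV_bool) (simp add: refl rot sum.distrib)
  also have "(\<Sum>a\<in>{0..<int n}. n * of_bool (\<not> int m dvd a - 0)) = n * (n - 2)"
    using card_non_residue_class_double[OF n m, of 0]
    by (simp add: Int_def flip: sum_distrib_left)
  finally show ?thesis by simp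
qed

section \<open>The mean distance\<close>
theorem theorem4p4:
  fixes n :: nat
  assumes "n \<ge> 3" and "even n"
  shows "mean_distance (with_proj (non_commuting_graph (dihedral_group n))) =
    ereal ((5 * (real n)\<^sup>2 - 14 * real n + 12) / ((2 * real n - 2) * (2 * real n - 3)))"
proof -
  let ?G = "dihedral_group n" and ?P = "dihedral_pairs n" and ?mult = "dihedral_mult n"
  obtain m where n: "n = 2 * m" using assms by blast
  then have m: "m > 1" using assms by simp
  interpret group ?G unfolding dihedral_group_def by (rule group_presented_group)
  obtain \<phi> where bij: "bij_betw \<phi> ?P (carrier ?G)"
    and mult: "\<And>x y. \<phi> x \<otimes>\<^bsub>?G\<^esub> \<phi> y = \<phi> (?mult x y)"
    using dihedral_group_iso_pairs[of n] assms by auto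
  note transport = card_center_bij[OF bij mult dihedral_mult_in_pairs]
    card_non_commuting_pairs_bij[OF bij mult dihedral_mult_in_pairs]
  have "card (group_center ?G) = 2"
    using transport(1) card_dihedral_center[OF n m] m n by simp
  moreover have "card (carrier ?G) = 2 * n" "finite (carrier ?G)"
    using bij_betw_same_card[OF bij] bij_betw_finite[OF bij]
    by (simp_all add: dihedral_pairs_def card_cartesian_product)
  moreover have "group_center ?G \<subseteq> carrier ?G" by (auto simp only: group_center_def)
  ultimately have verts: "card (carrier ?G - group_center ?G) = 2 * n - 2" and fin: "finite (carrier ?G)"
    by (simp_all add: card_Diff_subset finite_subset)
  have arcs: "card {(x, y) \<in> carrier ?G \<times> carrier ?G. x \<otimes>\<^bsub>?G\<^esub> y \<noteq> y \<otimes>\<^bsub>?G\<^esub> x} = 3 * n * (n - 2)"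
    using transport(2) card_dihedral_non_commuting[of n m] m n by simp
  have "transmission (with_proj (non_commuting_graph ?G)) =
      enat (2 * ((2 * n - 2) * (2 * n - 3)) - 3 * n * (n - 2))"
    using transmission_non_commuting_graph[OF fin] verts arcs by (simp add: numeral_3_eq_3)
  moreover have "real (2 * ((2 * n - 2) * (2 * n - 3)) - 3 * n * (n - 2)) = 5 * (real n)\<^sup>2 - 14 * real n + 12"
  proof -
    \<comment> \<open>This substitution removes the truncated subtractions of natural numbers.\<close>
    obtain k where "n = k + 3" using assms by (metis add.commute le_Suc_ex)
    then show ?thesis by (simp add: power2_eq_square algebra_simps)
  qed
  ultimately show ?thesis
    using assms by (simp add: mean_distance_def pverts_non_commuting_graph verts of_nat_diff)
qed

end
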